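(* Let $k\ge 3$ be an integer, $\mathbf N=(N_1,\dots,N_{k-1})\in\mathbb Z_{\ge 0}^{k-1}$ and $N=N_1+\cdots+N_{k-1}$. Put $\mathbf N^{(0)}=\mathbf N$ and $\mathbf N^{(i)}=(N_1+1,\dots,N_i+1,N_{i+1},\dots,N_{k-1})$ for $1\le i\le k-1$, let $T_i(z)=\mathcal W^{[2,k]}_{\mathbf N^{(i)}}(z)$ for $i=0,\dots,k-1$ be the corresponding $k$-reduced Wronskian--Hermite polynomials, and extend by $T_{i+k}=T_i$. Then $$\Big(D_z^2-\frac z2 D_z-\frac{K_i}{2}\Big)T_i(z)\cdot T_{i+1}(z)=0,\qquad i=0,\dots,k-1,$$ where $K_i=kN_{i+1}-N+1$ for $0\le i\le k-2$ and $K_{k-1}=-N-k+1$.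
   Context: $D_z$ is Hirota's bilinear operator: $D_z f\cdot g=f'g-fg'$, $D_z^2 f\cdot g=f''g-2f'g'+fg''$, and a constant $c$ acts as $c\,f g$. The polynomials $p_n^{[2]}(z)$ are defined by $\sum_{n\ge0}p_n^{[2]}(z)\epsilon^n=\exp(z\epsilon+\epsilon^2)$. For $\mathbf N\in\mathbb Z_{\ge0}^{k-1}$ with $N=\sum_r N_r$ let $$I_k(\mathbf N)=\bigcup_{r=1}^{k-1}\{r+kq: q\in\mathbb Z,\ 0\le q<N_r\}=\{\tilde n_1<\tilde n_2<\cdots<\tilde n_N\}.$$ The $k$-reduced Wronskian--Hermite polynomial is $$\mathcal W_{\mathbf N}^{[2,k]}(z)=\frac{\prod_{j=1}^N\tilde n_j!}{\prod_{1\le i<j\le N}(\tilde n_j-\tilde n_i)}\,\mathrm{Wr}\big[p^{[2]}_{\tilde n_1}(z),\dots,p^{[2]}_{\tilde n_N}(z)\big],$$ where $\mathrm{Wr}$ is the Wronskian $\det(d^{\,i-1}f_j/dz^{i-1})$; it equals $1$ when $N=0$. *)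

theory Defs
  imports
    "HOL-Computational_Algebra.Polynomial"
    "HOL-Computational_Algebra.Formal_Power_Series"
    "Jordan_Normal_Form.Determinant"
begin

text \<open>
  Polynomials in \<open>z\<close> are elements of \<^typ>\<open>complex poly\<close>, with \<open>z = [:0, 1:]\<close>. Generating
  functions in \<open>\<epsilon>\<close> are formal power series with such coefficients, with \<open>\<epsilon> = fps_X\<close>.
\<close>

definition hirota_D :: "complex poly \<Rightarrow> complex poly \<Rightarrow> complex poly" where
  "hirota_D f g = pderiv f * g - f * pderiv g"

definition hirota_D2 :: "complex poly \<Rightarrow> complex poly \<Rightarrow> complex poly" where
  "hirota_D2 f g = pderiv (pderiv f) * g - 2 * (pderiv f * pderiv g) + f * pderiv (pderiv g)"

text \<open>
  The library's \<open>fps_exp\<close> requires coefficients in a field, so the exponential series over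
  \<^typ>\<open>complex poly\<close> is written out.
\<close>
definition exp_series :: "complex poly fps" where
  "exp_series = Abs_fps (\<lambda>m. [:1 / fact m:])"

definition wh_p :: "nat \<Rightarrow> complex poly" where
  "wh_p n = fps_nth (exp_series oo (fps_const [:0, 1:] * fps_X + fps_X ^ 2)) n"

lemma poly_wh_p:
  "poly (wh_p n) z = fps_nth (fps_exp 1 oo (fps_const z * fps_X + fps_X ^ 2)) n"
proof -
  have "poly (fps_nth ((fps_const [:0, 1:] * fps_X + fps_X ^ 2) ^ m) j) z
      = fps_nth ((fps_const z * fps_X + fps_X ^ 2) ^ m) j" for m j
  proof (induction m arbitrary: j)
    case 0
    show ?case by simp
  next
    case (Suc m)
    have "poly (fps_nth (fps_const [:0, 1:] * fps_X + fps_X ^ 2) i) z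
        = fps_nth (fps_const z * fps_X + fps_X ^ 2) i" for i
      by (simp add: fps_X_power_nth)
    with Suc show ?case by (simp add: fps_mult_nth poly_sum)
  qed
  then show ?thesis
    by (simp add: wh_p_def exp_series_def fps_compose_nth poly_sum)
qed

text \<open>
  A tuple \<open>(N\<^sub>1, \<dots>, N\<^sub>k\<^sub>-\<^sub>1)\<close> is a function on \<^typ>\<open>nat\<close> of which only the values at
  \<open>1, \<dots>, k - 1\<close> matter.
\<close>
definition index_set :: "nat \<Rightarrow> (nat \<Rightarrow> nat) \<Rightarrow> nat set" where
  "index_set k N = (\<Union>r\<in>{1..k-1}. {r + k * q | q. q < N r})"

definition index_list :: "nat \<Rightarrow> (nat \<Rightarrow> nat) \<Rightarrow> nat list" where
  "index_list k N = sorted_list_of_set (index_set k N)"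

definition index_total :: "nat \<Rightarrow> (nat \<Rightarrow> nat) \<Rightarrow> nat" where
  "index_total k N = (\<Sum>r=1..k-1. N r)"

lemma finite_index_set: "finite (index_set k N)"
  by (auto simp: index_set_def)

lemma length_index_list: "length (index_list k N) = index_total k N"
proof -
  have "card (index_set k N) = (\<Sum>r=1..k-1. card {r + k * q | q. q < N r})"
    unfolding index_set_def
  proof (rule card_UN_disjoint)
    show "\<forall>r\<in>{1..k-1}. \<forall>s\<in>{1..k-1}. r \<noteq> s \<longrightarrow>
        {r + k * q | q. q < N r} \<inter> {s + k * q | q. q < N s} = {}"
    proof (intro ballI impI equals0I)
      fix r s x assume *: "r \<in> {1..k-1}" "s \<in> {1..k-1}" "r \<noteq> s"
        "x \<in> {r + k * q | q. q < N r} \<inter> {s + k * q | q. q < N s}"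
      then obtain a b where "x = r + k * a" "x = s + k * b" by blast
      moreover have "r < k" "s < k" using * by auto
      ultimately have "x mod k = r" "x mod k = s" by (metis mod_less mod_mult_self2)+
      with * show False by simp
    qed
  qed auto
  also have "\<dots> = (\<Sum>r=1..k-1. N r)"
  proof (rule sum.cong)
    fix r assume "r \<in> {1..k-1}"
    then have "inj_on (\<lambda>q. r + k * q) {..<N r}" by (auto intro!: inj_onI)
    moreover have "{r + k * q | q. q < N r} = (\<lambda>q. r + k * q) ` {..<N r}" by auto
    ultimately show "card {r + k * q | q. q < N r} = N r" by (simp add: card_image)
  qed simp
  finally show ?thesis
    by (simp add: index_list_def index_total_def)
qed

definition wronskian :: "complex poly list \<Rightarrow> complex poly" where
  "wronskian fs = det (mat (length fs) (length fs) (\<lambda>(i, j). (pderiv ^^ i) (fs ! j)))"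

definition wh_poly :: "nat \<Rightarrow> (nat \<Rightarrow> nat) \<Rightarrow> complex poly" where
  "wh_poly k N = (let ns = index_list k N; m = index_total k N in
     smult ((\<Prod>j<m. fact (ns ! j)) / (\<Prod>j<m. \<Prod>i<j. of_nat (ns ! j) - of_nat (ns ! i)))
       (wronskian (map wh_p ns)))"

definition shift_index :: "nat \<Rightarrow> (nat \<Rightarrow> nat) \<Rightarrow> nat \<Rightarrow> nat" where
  "shift_index i N r = (if 1 \<le> r \<and> r \<le> i then N r + 1 else N r)"

definition wh_T :: "nat \<Rightarrow> (nat \<Rightarrow> nat) \<Rightarrow> nat \<Rightarrow> complex poly" where
  "wh_T k N i = wh_poly k (shift_index (i mod k) N)"

definition wh_K :: "nat \<Rightarrow> (nat \<Rightarrow> nat) \<Rightarrow> nat \<Rightarrow> int" where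
  "wh_K k N i =
     (if i = k - 1 then - int (index_total k N) - int k + 1
      else int k * int (N (i + 1)) - int (index_total k N) + 1)"

end

theory Submission imports Defs
begin

text \<open>
  Each \<open>p\<^sub>n\<close> is an eigenfunction of \<open>2\<partial>\<^sup>2 + z\<partial>\<close> with eigenvalue \<open>n\<close>. If \<open>\<tau>\<close> is the Wronskian of
  \<open>n\<close> such functions and \<open>\<sigma>\<close> the Wronskian after appending one more, the eigenvalue equations give
  second-order relations for \<open>\<tau>\<close> and \<open>\<sigma>\<close>, and a three-term Pluecker relation between the
  determinants with one or two differentiated last rows turns these into the bilinear equation.
  For \<open>i < k - 1\<close> the polynomials \<open>T\<^sub>i\<close> and \<open>T\<^sub>i\<^sub>+\<^sub>1\<close> are such a pair up to constants, the appended index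
  being \<open>i + 1 + k N\<^sub>i\<^sub>+\<^sub>1\<close>. For \<open>i = k - 1\<close> one appends \<open>p\<^sub>0 = 1\<close>: the resulting indices are
  \<open>0, \<dots>, k - 1\<close> together with those of \<open>T\<^sub>0\<close> raised by \<open>k\<close>, and as \<open>p\<^sub>n' = p\<^sub>n\<^sub>-\<^sub>1\<close>, this Wronskian
  is that of \<open>T\<^sub>0\<close>.
\<close>

section \<open>Determinants as functions of their rows\<close>

text \<open>Rows are functions, so replacing a row is a function update, and one infinite array
  \<open>R\<close> supplies determinants of every size.\<close>

definition rdet :: "nat \<Rightarrow> (nat \<Rightarrow> nat \<Rightarrow> 'a::comm_ring_1) \<Rightarrow> 'a" where
  "rdet n R = det (mat n n (\<lambda>(i, j). R i j))"

lemma rdet_leibniz: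
  "rdet n R = (\<Sum>p | p permutes {0..<n}. signof p * (\<Prod>i=0..<n. R i (p i)))"
proof -
  have "(\<Prod>i=0..<n. mat n n (\<lambda>(i, j). R i j) $$ (i, p i)) = (\<Prod>i=0..<n. R i (p i))"
    if "p permutes {0..<n}" for p
    using permutes_in_image[OF that] by (intro prod.cong) auto
  then show ?thesis
    unfolding rdet_def by (subst det_def') (auto intro!: sum.cong)
qed

lemma rdet_cong:
  assumes "\<And>i j. i < n \<Longrightarrow> j < n \<Longrightarrow> R i j = R' i j"
  shows "rdet n R = rdet n R'"
  unfolding rdet_def by (intro arg_cong[where f = det] eq_matI) (auto simp: assms)

lemma rdet_identical_rows:
  assumes "i < n" "j < n" "i \<noteq> j" "R i = R j"
  shows "rdet n R = 0"
  unfolding rdet_def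
  by (rule det_identical_rows[OF mat_carrier assms(3,1,2)]) (use assms in \<open>auto simp: row_def\<close>)

lemma rdet_swap_rows:
  assumes "i < n" "j < n" "i \<noteq> j"
  shows "rdet n (R(i := R j, j := R i)) = - rdet n R"
proof -
  have "mat n n (\<lambda>(a, b). (R(i := R j, j := R i)) a b)
      = swaprows i j (mat n n (\<lambda>(a, b). R a b))"
    using assms by (intro eq_matI) (auto simp: mat_swaprows_def)
  then show ?thesis
    unfolding rdet_def using det_swaprows[OF assms mat_carrier] by metis
qed

text \<open>Cofactors along row \<open>l\<close> do not involve row \<open>l\<close>, so one
  coefficient vector \<open>C\<close> serves for every \<open>v\<close>.\<close>

lemma rdet_row_expansion:
  assumes "l < n"
  obtains C where "\<And>v. rdet n (R(l := v)) = (\<Sum>j<n. v j * C j)"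
proof
  fix v
  let ?A = "\<lambda>v. mat n n (\<lambda>(i, j). (R(l := v)) i j)"
  have "mat_delete (?A v) l j = mat_delete (?A (\<lambda>_. 0)) l j" if "j < n" for j
    using assms that by (intro eq_matI) (auto simp: mat_delete_def)
  then have cof: "cofactor (?A v) l j = cofactor (?A (\<lambda>_. 0)) l j" if "j < n" for j
    using that by (simp add: cofactor_def)
  have entry: "?A v $$ (l, j) = v j" if "j < n" for j
    using assms that by simp
  have "rdet n (R(l := v)) = (\<Sum>j<n. ?A v $$ (l, j) * cofactor (?A v) l j)"
    unfolding rdet_def by (rule laplace_expansion_row[OF mat_carrier assms])
  also have "\<dots> = (\<Sum>j<n. v j * cofactor (?A (\<lambda>_. 0)) l j)"
    by (intro sum.cong refl) (simp only: entry cof lessThan_iff)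
  finally show "rdet n (R(l := v)) = (\<Sum>j<n. v j * cofactor (?A (\<lambda>_. 0)) l j)" .
qed

lemma rdet_row_add:
  assumes "l < n"
  shows "rdet n (R(l := (\<lambda>j. v j + w j))) = rdet n (R(l := v)) + rdet n (R(l := w))"
  by (rule rdet_row_expansion[OF assms, of R]) (simp add: algebra_simps sum.distrib)

lemma rdet_row_scale:
  assumes "l < n"
  shows "rdet n (R(l := (\<lambda>j. c * v j))) = c * rdet n (R(l := v))"
  by (rule rdet_row_expansion[OF assms, of R]) (simp add: algebra_simps sum_distrib_left)

text \<open>Through a unit row, Wronskians of \<open>n\<close> and of \<open>n + 1\<close> functions
  fit into one Pluecker relation.\<close>

lemma rdet_last_row_unit:
  "rdet (Suc n) (R(n := (\<lambda>j. if j = n then 1 else 0))) = rdet n R"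
proof -
  let ?A = "mat (Suc n) (Suc n) (\<lambda>(i, j). (R(n := (\<lambda>j. if j = n then 1 else 0))) i j)"
  have "det ?A = (\<Sum>j<Suc n. ?A $$ (n, j) * cofactor ?A n j)"
    by (rule laplace_expansion_row) auto
  also have "\<dots> = cofactor ?A n n"
    by simp
  also have "\<dots> = det (mat_delete ?A n n)"
    by (simp add: cofactor_def)
  also have "mat_delete ?A n n = mat n n (\<lambda>(i, j). R i j)"
    by (intro eq_matI) (auto simp: mat_delete_def)
  finally show ?thesis
    by (simp add: rdet_def)
qed

lemma rdet_first_column_unit:
  assumes "\<And>i. R i 0 = (if i = 0 then 1 else 0)"
  shows "rdet (Suc n) R = rdet n (\<lambda>i j. R (Suc i) (Suc j))"
proof -
  let ?A = "mat (Suc n) (Suc n) (\<lambda>(i, j). R i j)"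
  have "det ?A = (\<Sum>i<Suc n. ?A $$ (i, 0) * cofactor ?A i 0)"
    by (rule laplace_expansion_column) auto
  also have "\<dots> = (\<Sum>i<Suc n. if i = 0 then cofactor ?A 0 0 else 0)"
    by (rule sum.cong) (auto simp: assms)
  also have "\<dots> = det (mat_delete ?A 0 0)"
    by (simp add: cofactor_def)
  also have "mat_delete ?A 0 0 = mat n n (\<lambda>(i, j). R (Suc i) (Suc j))"
    by (intro eq_matI) (auto simp: mat_delete_def)
  finally show ?thesis
    by (simp add: rdet_def)
qed

text \<open>Replacing row \<open>l\<close> changes a single factor of every Leibniz term, so
  identities for the sum over \<open>l\<close> can be checked permutation by permutation.\<close>

lemma rdet_row_update_leibniz:
  "(\<Sum>l<n. rdet n (R(l := A l)))
   = (\<Sum>p | p permutes {0..<n}. signof p * (\<Sum>l<n. A l (p l) * (\<Prod>i\<in>{0..<n}-{l}. R i (p i))))"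
proof -
  have "rdet n (R(l := A l))
      = (\<Sum>p | p permutes {0..<n}. signof p * (A l (p l) * (\<Prod>i\<in>{0..<n}-{l}. R i (p i))))"
    if "l < n" for l
  proof -
    have "(\<Prod>i=0..<n. (R(l := A l)) i (p i)) = A l (p l) * (\<Prod>i\<in>{0..<n}-{l}. R i (p i))" for p
      using that by (subst prod.remove[of _ l]) auto
    then show ?thesis by (simp add: rdet_leibniz)
  qed
  then have "(\<Sum>l<n. rdet n (R(l := A l))) = (\<Sum>l<n.
      \<Sum>p | p permutes {0..<n}. signof p * (A l (p l) * (\<Prod>i\<in>{0..<n}-{l}. R i (p i))))"
    by simp
  then show ?thesis
    by (subst (asm) sum.swap) (simp add: sum_distrib_left)
qed

lemma pderiv_rdet:
  fixes R :: "nat \<Rightarrow> nat \<Rightarrow> 'a::idom poly"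
  shows "pderiv (rdet n R) = (\<Sum>l<n. rdet n (R(l := (\<lambda>j. pderiv (R l j)))))"
proof -
  have *: "pderiv (signof p * q) = signof p * pderiv q" for p and q :: "'a poly"
    by (cases "sign p = 1") (auto simp: sign_def pderiv_minus)
  have sum: "pderiv (sum f A) = (\<Sum>x\<in>A. pderiv (f x))" for f :: "(nat \<Rightarrow> nat) \<Rightarrow> 'a poly" and A
    using higher_pderiv_sum[of 1 f A] by simp
  show ?thesis
    unfolding rdet_row_update_leibniz unfolding rdet_leibniz
    by (simp add: sum * pderiv_prod atLeast0LessThan mult.commute)
qed

text \<open>In the term of a permutation \<open>p\<close>, row \<open>l\<close> contributes the
  factor \<open>c (p l)\<close>; as \<open>p\<close> is bijective, these factors add up to the sum
  of all \<open>c j\<close>.\<close>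

lemma rdet_scaled_columns:
  "(\<Sum>l<n. rdet n (R(l := (\<lambda>j. c j * R l j)))) = (\<Sum>j<n. c j) * rdet n R"
proof -
  have "(\<Sum>l<n. c (p l) * R l (p l) * (\<Prod>i\<in>{0..<n}-{l}. R i (p i)))
      = (\<Sum>j<n. c j) * (\<Prod>i=0..<n. R i (p i))" if p: "p permutes {0..<n}" for p
  proof -
    have "(\<Sum>l<n. c (p l) * R l (p l) * (\<Prod>i\<in>{0..<n}-{l}. R i (p i)))
        = (\<Sum>l<n. c (p l) * (\<Prod>i=0..<n. R i (p i)))"
      by (rule sum.cong) (auto simp: prod.remove[of "{0..<n}"] mult.assoc)
    also have "\<dots> = (\<Sum>l<n. c (p l)) * (\<Prod>i=0..<n. R i (p i))"
      by (simp add: sum_distrib_right)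
    also have "(\<Sum>l<n. c (p l)) = (\<Sum>j<n. c j)"
      using sum.permute[OF p, of c] by (simp add: atLeast0LessThan o_def)
    finally show ?thesis .
  qed
  then have "(\<Sum>l<n. rdet n (R(l := (\<lambda>j. c j * R l j))))
      = (\<Sum>p | p permutes {0..<n}. signof p * ((\<Sum>j<n. c j) * (\<Prod>i=0..<n. R i (p i))))"
    unfolding rdet_row_update_leibniz by (intro sum.cong) auto
  then show ?thesis
    by (simp add: rdet_leibniz sum_distrib_left mult.left_commute)
qed

text \<open>Cramer's rule without division, from the product of the adjugate with its matrix:
  expanding \<open>R(i := c)\<close> along row \<open>i\<close> pairs \<open>c\<close> with column
  \<open>i\<close> of the adjugate.\<close>

lemma rdet_cramer:
  assumes "j < n"
  shows "(\<Sum>i<n. rdet n (R(i := c)) * R i j) = rdet n R * c j"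
proof -
  let ?A = "mat n n (\<lambda>(i, j). R i j)"
  have adj: "adj_mat ?A \<in> carrier_mat n n" "adj_mat ?A * ?A = det ?A \<cdot>\<^sub>m 1\<^sub>m n"
    using adj_mat[of ?A n] by auto
  have entry: "(\<Sum>i<n. adj_mat ?A $$ (l, i) * R i j) = (if l = j then rdet n R else 0)"
    if "l < n" for l
  proof -
    have "(adj_mat ?A * ?A) $$ (l, j) = (\<Sum>i<n. adj_mat ?A $$ (l, i) * R i j)"
      using adj(1) assms that by (simp add: scalar_prod_def atLeast0LessThan)
    then show ?thesis
      using assms that by (cases "l = j") (simp_all add: adj(2) rdet_def)
  qed
  have row: "rdet n (R(i := c)) = (\<Sum>l<n. c l * adj_mat ?A $$ (l, i))" if i: "i < n" for i
  proof -
    let ?B = "mat n n (\<lambda>(i', j). (R(i := c)) i' j)"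
    have "mat_delete ?B i l = mat_delete ?A i l" if "l < n" for l
      using i that by (intro eq_matI) (auto simp: mat_delete_def)
    then have cof: "cofactor ?B i l = adj_mat ?A $$ (l, i)" if "l < n" for l
      using i that by (simp add: cofactor_def adj_mat_def)
    have entry': "?B $$ (i, l) = c l" if "l < n" for l
      using i that by simp
    have "rdet n (R(i := c)) = (\<Sum>l<n. ?B $$ (i, l) * cofactor ?B i l)"
      unfolding rdet_def by (rule laplace_expansion_row[OF mat_carrier i])
    also have "\<dots> = (\<Sum>l<n. c l * adj_mat ?A $$ (l, i))"
      by (intro sum.cong refl) (simp only: entry' cof lessThan_iff)
    finally show ?thesis .
  qed
  have "(\<Sum>i<n. rdet n (R(i := c)) * R i j)
      = (\<Sum>i<n. \<Sum>l<n. c l * (adj_mat ?A $$ (l, i) * R i j))"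
    by (rule sum.cong) (simp_all add: row sum_distrib_right mult.assoc)
  also have "\<dots> = (\<Sum>l<n. c l * (\<Sum>i<n. adj_mat ?A $$ (l, i) * R i j))"
    by (subst sum.swap) (simp add: sum_distrib_left)
  also have "\<dots> = (\<Sum>l<n. if l = j then c l * rdet n R else 0)"
    by (rule sum.cong) (auto simp: entry)
  also have "\<dots> = rdet n R * c j"
    using assms by (subst sum.delta) (auto simp: mult.commute)
  finally show ?thesis .
qed

text \<open>By Cramer's rule, \<open>c\<close> times the determinant with rows \<open>\<dots>, a, b\<close> is a combination
  of these rows. Substituting it into the determinant with rows \<open>\<dots>, c, d\<close> leaves only the
  contributions of \<open>a\<close> and \<open>b\<close>.\<close>
lemma rdet_plucker:
  fixes R :: "nat \<Rightarrow> nat \<Rightarrow> 'a::comm_ring_1" and m :: nat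
  defines "\<phi> \<equiv> \<lambda>v w. rdet (Suc (Suc m)) (R(m := v, Suc m := w))"
  shows "\<phi> a b * \<phi> c d - \<phi> a c * \<phi> b d + \<phi> a d * \<phi> b c = 0"
proof -
  let ?n = "Suc (Suc m)"
  define P where "P = R(m := a, Suc m := b)"
  have swap: "R(m := v, Suc m := w) = R(Suc m := w, m := v)" for v w
    by (simp add: fun_upd_twist)
  have "\<exists>C. \<forall>v. \<phi> v d = (\<Sum>j<?n. v j * C j)"
    unfolding \<phi>_def swap by (rule rdet_row_expansion[of m ?n "R(Suc m := d)"]) auto
  then obtain C where C: "\<phi> v d = (\<Sum>j<?n. v j * C j)" for v by blast
  \<comment> \<open>A row \<open>R i\<close> with \<open>i < m\<close> is still present as row
    \<open>i\<close>, so only the last two rows of \<open>P\<close> contribute below.\<close>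
  have *: "\<phi> (R i) d = 0" if "i < m" for i
    unfolding \<phi>_def
    by (rule rdet_identical_rows[of i _ m]) (use that in auto)
  have "\<phi> a b = rdet ?n P"
    by (simp add: \<phi>_def P_def)
  then have "\<phi> a b * \<phi> c d = (\<Sum>j<?n. rdet ?n P * c j * C j)"
    by (simp add: C sum_distrib_left mult.assoc del: sum.lessThan_Suc)
  also have "\<dots> = (\<Sum>j<?n. \<Sum>i<?n. rdet ?n (P(i := c)) * (P i j * C j))"
  proof (rule sum.cong[OF refl])
    fix j assume "j \<in> {..<?n}"
    then have "(\<Sum>i<?n. rdet ?n (P(i := c)) * P i j) = rdet ?n P * c j"
      by (intro rdet_cramer) (simp only: lessThan_iff)
    then show "rdet ?n P * c j * C j = (\<Sum>i<?n. rdet ?n (P(i := c)) * (P i j * C j))"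
      unfolding mult.assoc[symmetric] sum_distrib_right[symmetric] by (simp only:)
  qed
  also have "\<dots> = (\<Sum>i<?n. rdet ?n (P(i := c)) * \<phi> (P i) d)"
    by (subst sum.swap) (simp add: C sum_distrib_left del: sum.lessThan_Suc)
  also have "\<dots> = rdet ?n (P(m := c)) * \<phi> a d + rdet ?n (P(Suc m := c)) * \<phi> b d"
    by (simp add: * P_def)
  also have "rdet ?n (P(Suc m := c)) = \<phi> a c"
    by (simp add: P_def \<phi>_def)
  also have "rdet ?n (P(m := c)) = - \<phi> b c"
    unfolding \<phi>_def
    using rdet_swap_rows[of m ?n "Suc m" "R(m := b, Suc m := c)"]
    by (simp add: P_def fun_upd_twist)
  finally show ?thesis
    by (simp add: algebra_simps)
qed

section \<open>Bilinear equation for Wronskians of eigenfunctions\<close>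

text \<open>\<open>F i j\<close> plays the role of the \<open>i\<close>-th derivative of the
  \<open>j\<close>-th function, so \<open>rdet n F\<close> is the Wronskian of the first
  \<open>n\<close> functions.\<close>

context
  fixes F :: "nat \<Rightarrow> nat \<Rightarrow> complex poly"
  assumes F_Suc: "pderiv (F i j) = F (Suc i) j"
begin

text \<open>Differentiating a row \<open>l < m\<close> yields a copy of row \<open>l + 1\<close>;
  only the last row survives.\<close>

lemma pderiv_rdet_derivatives:
  "pderiv (rdet (Suc m) F) = rdet (Suc m) (F(m := F (Suc m)))"
proof -
  have "rdet (Suc m) (F(l := F (Suc l))) = 0" if "l < m" for l
    by (rule rdet_identical_rows[of l _ "Suc l"]) (use that in auto)
  then show ?thesis
    by (simp add: pderiv_rdet F_Suc)
qed

text \<open>The sum stays unevaluated because \<open>rdet_eigenfunctions\<close> contains the same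
  sum with the opposite sign.\<close>

lemma pderiv2_rdet_derivatives:
  "pderiv (pderiv (rdet (Suc m) F))
   = rdet (Suc m) (F(m := F (m + 2)))
     + (\<Sum>l<m. rdet (Suc m) (F(m := F (Suc m), l := F (Suc l))))"
  by (simp add: pderiv_rdet_derivatives pderiv_rdet[of _ "F(m := F (Suc m))"] F_Suc)

text \<open>For \<open>l = m - 1\<close> the two determinants differ by exchanging the last two
  rows; for smaller \<open>l\<close> each has a repeated row.\<close>

lemma rdet_double_shift:
  assumes "l < m"
  shows "rdet (Suc m) (F(l := F (l + 2))) = - rdet (Suc m) (F(m := F (Suc m), l := F (Suc l)))"
proof (cases "Suc l = m")
  case True
  have "F(m := F (Suc m), l := F (Suc l)) =
      (F(l := F (l + 2)))(l := (F(l := F (l + 2))) m, m := (F(l := F (l + 2))) l)"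
    using True by (auto simp: fun_eq_iff)
  then show ?thesis
    using rdet_swap_rows[of l "Suc m" m "F(l := F (l + 2))"] assms by simp
next
  case False
  have "rdet (Suc m) (F(l := F (l + 2))) = 0"
    by (rule rdet_identical_rows[of l _ "l + 2"]) (use assms False in auto)
  moreover have "rdet (Suc m) (F(m := F (Suc m), l := F (Suc l))) = 0"
    by (rule rdet_identical_rows[of l _ "Suc l"]) (use assms False in auto)
  ultimately show ?thesis by simp
qed

text \<open>Applying \<open>2\<partial>\<^sup>2 + z\<partial>\<close> to one column at a time multiplies the determinant by the sum
  of the eigenvalues; summing over the rows instead gives the left-hand side.\<close>
lemma rdet_eigenfunctions:
  assumes ode: "\<And>i j. 2 * F (i + 2) j + [:0, 1:] * F (Suc i) j + of_nat i * F i j = c j * F i j"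
  shows "2 * (rdet (Suc m) (F(m := F (m + 2)))
           - (\<Sum>l<m. rdet (Suc m) (F(m := F (Suc m), l := F (Suc l)))))
         + [:0, 1:] * pderiv (rdet (Suc m) F) + (\<Sum>l<Suc m. of_nat l) * rdet (Suc m) F
         = (\<Sum>j<Suc m. c j) * rdet (Suc m) F"
proof -
  let ?n = "Suc m"
  have "rdet ?n (F(l := (\<lambda>j. c j * F l j)))
      = 2 * rdet ?n (F(l := F (l + 2))) + [:0, 1:] * rdet ?n (F(l := F (Suc l)))
        + of_nat l * rdet ?n F" if "l < ?n" for l
  proof -
    have "(\<lambda>j. c j * F l j)
        = (\<lambda>j. (2 * F (l + 2) j + [:0, 1:] * F (Suc l) j) + of_nat l * F l j)"
      by (simp only: ode)
    then show ?thesis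
      by (simp only: rdet_row_add[OF that] rdet_row_scale[OF that] fun_upd_triv)
  qed
  then have "(\<Sum>l<?n. rdet ?n (F(l := (\<lambda>j. c j * F l j))))
      = (\<Sum>l<?n. 2 * rdet ?n (F(l := F (l + 2))) + [:0, 1:] * rdet ?n (F(l := F (Suc l)))
        + of_nat l * rdet ?n F)"
    by (intro sum.cong) auto
  also have "\<dots> = 2 * (\<Sum>l<?n. rdet ?n (F(l := F (l + 2))))
      + [:0, 1:] * (\<Sum>l<?n. rdet ?n (F(l := F (Suc l)))) + (\<Sum>l<?n. of_nat l) * rdet ?n F"
    by (simp only: sum.distrib sum_distrib_left sum_distrib_right)
  also have "(\<Sum>l<?n. rdet ?n (F(l := F (Suc l)))) = pderiv (rdet ?n F)"
    by (simp only: pderiv_rdet F_Suc)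
  also have "(\<Sum>l<?n. rdet ?n (F(l := F (l + 2)))) = rdet ?n (F(m := F (m + 2)))
      - (\<Sum>l<m. rdet ?n (F(m := F (Suc m), l := F (Suc l))))"
  proof -
    have "(\<Sum>l<m. rdet ?n (F(l := F (l + 2))))
        = (\<Sum>l<m. - rdet ?n (F(m := F (Suc m), l := F (Suc l))))"
      by (intro sum.cong refl rdet_double_shift) simp
    then show ?thesis
      by (simp add: sum_negf)
  qed
  finally show ?thesis
    by (simp only: rdet_scaled_columns)
qed

lemma rdet_bilinear:
  assumes ode: "\<And>i j. 2 * F (i + 2) j + [:0, 1:] * F (Suc i) j + of_nat i * F i j = c j * F i j"
  shows "2 * hirota_D2 (rdet n F) (rdet (Suc n) F)
         - [:0, 1:] * hirota_D (rdet n F) (rdet (Suc n) F)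
         - (c n - of_nat n) * (rdet n F * rdet (Suc n) F) = 0"
proof (cases n)
  case 0
  \<comment> \<open>The empty Wronskian has no last row to differentiate; the claim is then the
    eigenvalue equation of the first function.\<close>
  have [simp]: "rdet 0 F = 1" "rdet (Suc 0) F = F 0 0"
    by (simp_all add: rdet_def det_single)
  define z :: "complex poly" where "z = [:0, 1:]"
  have "2 * F 2 0 + z * F (Suc 0) 0 = c 0 * F 0 0"
    using ode[of 0 0] by (simp add: z_def numeral_2_eq_2)
  then have "2 * hirota_D2 1 (F 0 0) - z * hirota_D 1 (F 0 0) - c 0 * F 0 0 = 0"
    by (simp add: hirota_D_def hirota_D2_def F_Suc numeral_2_eq_2)
  then show ?thesis
    using 0 by (simp add: z_def)
next
  case (Suc m)
  define \<tau> \<sigma> where "\<tau> = rdet n F" and "\<sigma> = rdet (Suc n) F"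
  \<comment> \<open>\<open>A\<close> and \<open>C\<close> differentiate the last row twice;
    \<open>B\<close> and \<open>D\<close> differentiate two rows once each.\<close>
  define A where "A = rdet n (F(m := F (m + 2)))"
  define B where "B = (\<Sum>l<m. rdet n (F(m := F (Suc m), l := F (Suc l))))"
  define C where "C = rdet (Suc n) (F(n := F (n + 2)))"
  define D where "D = rdet (Suc n) (F(m := F n, n := F (Suc n)))"
  have \<tau>': "pderiv \<tau> = rdet n (F(m := F n))"
    unfolding \<tau>_def Suc by (rule pderiv_rdet_derivatives)
  have \<sigma>': "pderiv \<sigma> = rdet (Suc n) (F(n := F (Suc n)))"
    unfolding \<sigma>_def by (rule pderiv_rdet_derivatives)
  have \<tau>'': "pderiv (pderiv \<tau>) = A + B"
    unfolding \<tau>_def A_def B_def Suc by (rule pderiv2_rdet_derivatives)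
  \<comment> \<open>Every summand except \<open>l = m\<close> repeats a row. The Pluecker relation
    below needs this single determinant.\<close>
  have D: "(\<Sum>l<n. rdet (Suc n) (F(n := F (Suc n), l := F (Suc l)))) = D"
  proof -
    have "rdet (Suc n) (F(n := F (Suc n), l := F (Suc l))) = 0" if "l < m" for l
      by (rule rdet_identical_rows[of l _ "Suc l"]) (use that Suc in auto)
    then show ?thesis
      by (simp add: D_def Suc fun_upd_twist)
  qed
  have \<sigma>'': "pderiv (pderiv \<sigma>) = C + D"
    using pderiv2_rdet_derivatives[of n] by (simp add: \<sigma>_def C_def D)
  have ode_\<tau>: "2 * (A - B) + [:0, 1:] * pderiv \<tau> + (\<Sum>l<n. of_nat l) * \<tau> = (\<Sum>j<n. c j) * \<tau>"
    unfolding \<tau>_def A_def B_def Suc by (rule rdet_eigenfunctions[OF ode])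
  have ode_\<sigma>: "2 * (C - D) + [:0, 1:] * pderiv \<sigma> + ((\<Sum>l<n. of_nat l) + of_nat n) * \<sigma>
      = ((\<Sum>j<n. c j) + c n) * \<sigma>"
    using rdet_eigenfunctions[OF ode, of n] by (simp add: \<sigma>_def C_def D)
  have plucker: "\<sigma> * A - pderiv \<sigma> * pderiv \<tau> + \<tau> * D = 0"
  proof -
    \<comment> \<open>The relation sought is the Pluecker relation for the rows \<open>F m\<close>,
      \<open>F n\<close>, \<open>F (Suc n)\<close> and the unit row \<open>e\<close>.\<close>
    define e :: "nat \<Rightarrow> complex poly" where "e = (\<lambda>j. if j = n then 1 else 0)"
    have e: "rdet n (F(m := v)) = rdet (Suc n) (F(m := v, n := e))" for v
      unfolding e_def by (rule rdet_last_row_unit[symmetric])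
    have mn: "Suc m = n" "m + 2 = Suc n"
      using Suc by simp_all
    have "\<sigma> = rdet (Suc n) (F(m := F m, n := F n))"
      by (simp add: \<sigma>_def)
    moreover have "pderiv \<sigma> = rdet (Suc n) (F(m := F m, n := F (Suc n)))"
      by (simp add: \<sigma>')
    moreover have "\<tau> = rdet (Suc n) (F(m := F m, n := e))"
      using e[of "F m"] by (simp add: \<tau>_def)
    moreover have "pderiv \<tau> = rdet (Suc n) (F(m := F n, n := e))"
      unfolding \<tau>' by (rule e)
    moreover have "A = rdet (Suc n) (F(m := F (Suc n), n := e))"
      unfolding A_def mn by (rule e)
    ultimately show ?thesis
      using rdet_plucker[of m F "F m" "F n" "F (Suc n)" e, unfolded mn] by (simp only: D_def)
  qed
  have combine: "2 * ((A + B) * \<sigma> - 2 * (\<tau>' * \<sigma>') + \<tau> * (C + D)) - z * (\<tau>' * \<sigma> - \<tau> * \<sigma>')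
        - (x - y) * (\<tau> * \<sigma>) = 0"
    if "2 * (A - B) + z * \<tau>' + s * \<tau> = t * \<tau>"
      and "2 * (C - D) + z * \<sigma>' + (s + y) * \<sigma> = (t + x) * \<sigma>"
      and "\<sigma> * A - \<sigma>' * \<tau>' + \<tau> * D = 0"
    for \<tau>' \<sigma>' z s t x y :: "complex poly"
  proof -
    \<comment> \<open>Cross-multiplying the two eigenvalue relations gives \<open>A\<close> and
      \<open>D\<close> the wrong sign; four times the Pluecker relation corrects this and supplies
      the mixed derivative term. The sums \<open>s\<close> and \<open>t\<close> cancel, leaving
      \<open>x - y\<close>.\<close>
    have "2 * ((A + B) * \<sigma> - 2 * (\<tau>' * \<sigma>') + \<tau> * (C + D)) - z * (\<tau>' * \<sigma> - \<tau> * \<sigma>')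
          - (x - y) * (\<tau> * \<sigma>)
        = \<tau> * (2 * (C - D) + z * \<sigma>' + (s + y) * \<sigma> - (t + x) * \<sigma>)
          - \<sigma> * (2 * (A - B) + z * \<tau>' + s * \<tau> - t * \<tau>)
          + 4 * (\<sigma> * A - \<sigma>' * \<tau>' + \<tau> * D)"
      by (simp add: algebra_simps)
    then show ?thesis
      by (simp only: that diff_self mult_zero_right add_0_right)
  qed
  have "2 * (pderiv (pderiv \<tau>) * \<sigma> - 2 * (pderiv \<tau> * pderiv \<sigma>) + \<tau> * pderiv (pderiv \<sigma>))
         - [:0, 1:] * (pderiv \<tau> * \<sigma> - \<tau> * pderiv \<sigma>) - (c n - of_nat n) * (\<tau> * \<sigma>) = 0"
    unfolding \<tau>'' \<sigma>'' by (rule combine[OF ode_\<tau> ode_\<sigma> plucker])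
  then show ?thesis
    by (simp only: hirota_D_def hirota_D2_def \<tau>_def \<sigma>_def)
qed

end

section \<open>Wronskian--Hermite polynomials\<close>

lemma wh_p_0 [simp]: "wh_p 0 = 1"
  by (simp add: wh_p_def exp_series_def fps_compose_nth)

text \<open>Coefficient comparison in \<open>G' = (z + 2 \<epsilon>) G\<close>, where
  \<open>G\<close> is the generating function and the derivative is in \<epsilon>.\<close>

lemma wh_p_recurrence:
  "of_nat (Suc n) * wh_p (Suc n) = [:0, 1:] * wh_p n + (if n = 0 then 0 else 2 * wh_p (n - 1))"
proof -
  let ?B = "fps_const [:0, 1:] * fps_X + fps_X ^ 2 :: complex poly fps"
  let ?E = "exp_series oo ?B"
  have "fps_deriv exp_series = exp_series"
    by (rule fps_ext) (simp add: exp_series_def of_nat_poly del: of_nat_Suc)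
  then have "fps_deriv ?E = ?E * (fps_const [:0, 1:] + 2 * fps_X)"
    by (subst fps_compose_deriv) (simp_all add: power2_eq_square)
  then have "fps_nth (fps_deriv ?E) n = fps_nth (fps_const [:0, 1:] * ?E + 2 * (fps_X * ?E)) n"
    by (simp add: algebra_simps)
  then show ?thesis
    by (simp add: wh_p_def fps_numeral_fps_const)
qed

text \<open>Differentiating the recurrence for \<open>n = Suc l\<close> leaves \<open>wh_p l\<close>
  plus lower derivatives, which the induction hypothesis and the recurrence for \<open>l\<close>
  turn into \<open>l\<close> times \<open>wh_p l\<close>; then \<open>n\<close> cancels.\<close>

lemma pderiv_wh_p: "pderiv (wh_p n) = (if n = 0 then 0 else wh_p (n - 1))"
proof (induction n rule: less_induct)
  case (less n)
  show ?case
  proof (cases n)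
    case (Suc l)
    have "of_nat n * pderiv (wh_p n) = pderiv (of_nat (Suc l) * wh_p (Suc l))"
      by (simp add: Suc of_nat_poly pderiv_smult del: of_nat_Suc)
    also have "\<dots> = wh_p l + ([:0, 1:] * pderiv (wh_p l)
        + (if l = 0 then 0 else 2 * pderiv (wh_p (l - 1))))"
      by (simp only: wh_p_recurrence) (simp add: pderiv_add pderiv_mult pderiv_pCons)
    also have "[:0, 1:] * pderiv (wh_p l) + (if l = 0 then 0 else 2 * pderiv (wh_p (l - 1)))
        = of_nat l * wh_p l"
    proof (cases l)
      case (Suc q)
      then show ?thesis
        using less.IH[of l] less.IH[of q] wh_p_recurrence[of q] \<open>n = Suc l\<close> by simp
    qed simp
    finally have "of_nat n * pderiv (wh_p n) = of_nat n * wh_p l"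
      by (simp add: Suc algebra_simps)
    moreover have "of_nat n \<noteq> (0 :: complex poly)"
      unfolding Suc by (rule of_nat_neq_0)
    ultimately have "pderiv (wh_p n) = wh_p l"
      by (simp only: mult_cancel_left simp_thms)
    then show ?thesis
      using Suc by simp
  qed simp
qed

text \<open>Since derivatives lower the index, this is the recurrence again.\<close>

lemma wh_p_ode: "2 * pderiv (pderiv (wh_p n)) + [:0, 1:] * pderiv (wh_p n) = of_nat n * wh_p n"
proof (cases n)
  case (Suc l)
  then show ?thesis
    using wh_p_recurrence[of l] by (simp add: pderiv_wh_p)
qed (simp add: pderiv_wh_p)

text \<open>The third summand comes from the Leibniz rule applied to \<open>z\<close> times the
  first derivative.\<close>

lemma higher_pderiv_wh_p_ode:
  "2 * (pderiv ^^ (i + 2)) (wh_p n) + [:0, 1:] * (pderiv ^^ Suc i) (wh_p n)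
     + of_nat i * (pderiv ^^ i) (wh_p n) = of_nat n * (pderiv ^^ i) (wh_p n)"
proof (induction i)
  case (Suc i)
  from arg_cong[OF this, of pderiv] show ?case
    by (simp add: pderiv_add pderiv_mult pderiv_pCons algebra_simps)
qed (use wh_p_ode[of n] in simp)

section \<open>Wronskians of the polynomials \<open>wh_p n\<close>\<close>

lemma wronskian_rdet: "wronskian fs = rdet (length fs) (\<lambda>i j. (pderiv ^^ i) (fs ! j))"
  by (simp add: wronskian_def rdet_def)

lemma wronskian_wh_p_bilinear:
  fixes xs :: "nat list" and m :: nat
  defines "\<tau> \<equiv> wronskian (map wh_p xs)" and "\<sigma> \<equiv> wronskian (map wh_p (xs @ [m]))"
  shows "2 * hirota_D2 \<tau> \<sigma> - [:0, 1:] * hirota_D \<tau> \<sigma>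
     - of_int (int m - int (length xs)) * (\<tau> * \<sigma>) = 0"
proof -
  \<comment> \<open>Placing \<open>m\<close> last lets one array serve both Wronskians. Every column
    is some \<open>wh_p\<close>, so the eigenvalue equation holds for all \<open>j\<close>.\<close>
  define F where "F i j = (pderiv ^^ i) (wh_p ((xs @ [m]) ! j))" for i j
  have "\<tau> = rdet (length xs) F" "\<sigma> = rdet (Suc (length xs)) F"
    unfolding \<tau>_def \<sigma>_def wronskian_rdet F_def
    by (auto intro!: rdet_cong simp: nth_append simp del: map_append)
  moreover have "pderiv (F i j) = F (Suc i) j" for i j
    by (simp add: F_def)
  moreover have "2 * F (i + 2) j + [:0, 1:] * F (Suc i) j + of_nat i * F i j
      = of_nat ((xs @ [m]) ! j) * F i j" for i j
    unfolding F_def by (rule higher_pderiv_wh_p_ode)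
  ultimately show ?thesis
    using rdet_bilinear[of F "\<lambda>j. of_nat ((xs @ [m]) ! j)" "length xs"] by simp
qed

text \<open>The scalar is the sign of the permutation; its mere existence is recorded because the
  bilinear equation is homogeneous in each factor.\<close>

lemma wronskian_permute:
  assumes "mset fs = mset gs"
  obtains s where "wronskian fs = smult s (wronskian gs)"
proof -
  obtain p where p: "p permutes {..<length gs}" "permute_list p gs = fs"
    by (rule mset_eq_permutation[OF assms])
  let ?n = "length gs"
  let ?A = "mat ?n ?n (\<lambda>(i, j). (pderiv ^^ i) (gs ! j))"
  have len: "length fs = ?n"
    using assms by (rule mset_eq_length)
  have nth: "fs ! j = gs ! p j" if "j < ?n" for j
    using p that by (metis permute_list_nth)
  have bound: "p j < ?n" if "j < ?n" for j
    using permutes_in_image[OF p(1)] that by simp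
  \<comment> \<open>The functions sit in columns, whereas \<open>det_permute_rows\<close> permutes
    rows; hence the transpositions.\<close>
  have "mat ?n ?n (\<lambda>(i, j). (pderiv ^^ i) (fs ! j))
      = transpose_mat (mat ?n ?n (\<lambda>(i, j). transpose_mat ?A $$ (p i, j)))"
    by (rule eq_matI) (auto simp: nth bound)
  then have "wronskian fs = det (mat ?n ?n (\<lambda>(i, j). transpose_mat ?A $$ (p i, j)))"
    by (simp add: wronskian_def len det_transpose[OF mat_carrier])
  also have "\<dots> = signof p * det (transpose_mat ?A)"
    using p(1) by (intro det_permute_rows) (auto simp: atLeast0LessThan)
  also have "\<dots> = smult (of_int (sign p)) (wronskian gs)"
    by (simp add: wronskian_def det_transpose[OF mat_carrier] sign_def)
  finally show thesis
    by (rule that)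
qed

text \<open>The column of \<open>wh_p 0 = 1\<close> is a unit vector; the remaining block starts
  with first derivatives, which lower every index by one.\<close>

lemma wronskian_wh_p_Cons_0: "wronskian (map wh_p (0 # map Suc xs)) = wronskian (map wh_p xs)"
proof -
  have *: "(pderiv ^^ i) 1 = (if i = 0 then 1 else 0 :: complex poly)" for i
    by (cases i) (simp_all del: funpow.simps add: funpow_Suc_right)
  have "wronskian (map wh_p (0 # map Suc xs))
      = rdet (Suc (length xs)) (\<lambda>i j. (pderiv ^^ i) (wh_p ((0 # map Suc xs) ! j)))"
    unfolding wronskian_rdet length_map list.size length_Cons add_Suc_right add_0_right
    by (rule rdet_cong) (subst nth_map; simp)
  also have "\<dots> = rdet (length xs) (\<lambda>i j. (pderiv ^^ Suc i) (wh_p (map Suc xs ! j)))"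
    by (subst rdet_first_column_unit) (simp_all add: * del: funpow.simps)
  also have "\<dots> = wronskian (map wh_p xs)"
    unfolding wronskian_rdet length_map
    by (rule rdet_cong) (simp add: funpow_Suc_right pderiv_wh_p del: funpow.simps)
  finally show ?thesis .
qed

lemma wronskian_wh_p_shift:
  "wronskian (map wh_p ([0..<k] @ map ((+) k) xs)) = wronskian (map wh_p xs)"
proof (induction k)
  case (Suc k)
  have "[0..<Suc k] @ map ((+) (Suc k)) xs = 0 # map Suc ([0..<k] @ map ((+) k) xs)"
    by (simp add: upt_conv_Cons map_Suc_upt o_def del: upt_Suc)
  then show ?case
    using Suc wronskian_wh_p_Cons_0 by metis
qed (simp add: map_idI)

text \<open>The scalar absorbs the normalisation and the sign of the reordering, so the indices may
  be listed in any order.\<close>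

lemma wh_poly_wronskian:
  assumes "distinct xs" "set xs = index_set k N"
  obtains s where "wh_poly k N = smult s (wronskian (map wh_p xs))"
proof -
  have "mset (index_list k N) = mset xs"
    using assms by (subst set_eq_iff_mset_eq_distinct[symmetric])
      (auto simp: index_list_def finite_index_set)
  then have "mset (map wh_p (index_list k N)) = mset (map wh_p xs)"
    by simp
  then obtain s where "wronskian (map wh_p (index_list k N)) = smult s (wronskian (map wh_p xs))"
    by (rule wronskian_permute)
  then show thesis
    by (intro that) (simp add: wh_poly_def Let_def)
qed

section \<open>Index sets under raising entries of the tuple\<close>

lemma index_total_shift_index:
  assumes "i < k"
  shows "index_total k (shift_index i N) = index_total k N + i"
proof -
  have "index_total k (shift_index i N) = (\<Sum>r=1..k-1. N r + (if r \<in> {1..i} then 1 else 0))"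
    unfolding index_total_def by (intro sum.cong) (auto simp: shift_index_def)
  also have "\<dots> = index_total k N + (\<Sum>r\<in>{1..k-1} \<inter> {1..i}. 1)"
    unfolding sum.distrib index_total_def by (subst sum.inter_restrict) auto
  also have "{1..k-1} \<inter> {1..i} = {1..i}"
    using assms by auto
  finally show ?thesis by simp
qed

text \<open>With residue and quotient modulo \<open>k\<close>, the set identities below become case
  distinctions on a residue.\<close>

lemma mem_index_set:
  assumes "k > 0"
  shows "x \<in> index_set k N \<longleftrightarrow> x mod k \<noteq> 0 \<and> x div k < N (x mod k)"
proof
  assume "x \<in> index_set k N"
  then obtain r q where *: "r \<in> {1..k-1}" "q < N r" "x = r + k * q"
    by (auto simp: index_set_def)
  then have "r < k" by auto
  then show "x mod k \<noteq> 0 \<and> x div k < N (x mod k)"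
    using * by simp
next
  assume *: "x mod k \<noteq> 0 \<and> x div k < N (x mod k)"
  have "x mod k < k" using assms by simp
  then have "x mod k \<in> {1..k-1}" using * by auto
  moreover have "x = x mod k + k * (x div k)" by simp
  ultimately show "x \<in> index_set k N"
    unfolding index_set_def using * by blast
qed

text \<open>Only the residue class of \<open>Suc i\<close> changes: it gains its first missing
  element, whose quotient is \<open>N (Suc i)\<close>.\<close>

lemma index_set_shift_index_Suc:
  assumes "Suc i < k"
  shows "index_set k (shift_index (Suc i) N)
       = insert (Suc i + k * N (Suc i)) (index_set k (shift_index i N))"
    and "Suc i + k * N (Suc i) \<notin> index_set k (shift_index i N)"
proof -
  have k: "k > 0" using assms by simp
  show "Suc i + k * N (Suc i) \<notin> index_set k (shift_index i N)"
    using assms k div_mult_self2[of k "Suc i" "N (Suc i)"] mod_mult_self2[of "Suc i" k "N (Suc i)"]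
    by (simp add: mem_index_set shift_index_def)
  show "index_set k (shift_index (Suc i) N)
       = insert (Suc i + k * N (Suc i)) (index_set k (shift_index i N))"
  proof (rule Set.set_eqI)
    fix x
    have "x = Suc i + k * N (Suc i) \<longleftrightarrow> x mod k = Suc i \<and> x div k = N (Suc i)"
      using assms by (auto simp del: add_Suc) (metis mod_mult_div_eq)
    then show "x \<in> index_set k (shift_index (Suc i) N)
        \<longleftrightarrow> x \<in> insert (Suc i + k * N (Suc i)) (index_set k (shift_index i N))"
      unfolding insert_iff mem_index_set[OF k] shift_index_def
      by (cases "x mod k = Suc i") (auto simp: le_Suc_eq)
  qed
qed

text \<open>Raising every entry moves each nonzero residue class up by \<open>k\<close> and adds its
  residue as a new smallest element; \<open>0\<close> completes these residues to
  \<open>{0..<k}\<close>.\<close>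

lemma index_set_shift_index_full:
  assumes "k > 0"
  shows "insert 0 (index_set k (shift_index (k - 1) N)) = {0..<k} \<union> (+) k ` index_set k N"
proof (rule Set.set_eqI)
  fix x
  have shift: "x \<in> (+) k ` index_set k N \<longleftrightarrow> k \<le> x \<and> x - k \<in> index_set k N"
    by (auto simp: image_iff) (metis le_add_diff_inverse)
  have "x mod k \<le> k - 1"
    using assms by (simp add: less_Suc_eq_le[symmetric])
  moreover have "x mod k = 0 \<longleftrightarrow> x = 0" "x div k = 0" if "x < k"
    using that by simp_all
  moreover have "(x - k) mod k = x mod k" "(x - k) div k = x div k - 1" "x div k > 0" if "k \<le> x"
    using that assms by (simp_all add: le_mod_geq le_div_geq div_greater_zero_iff)
  ultimately show "x \<in> insert 0 (index_set k (shift_index (k - 1) N))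
      \<longleftrightarrow> x \<in> {0..<k} \<union> (+) k ` index_set k N"
    using assms unfolding insert_iff Un_iff shift mem_index_set[OF assms] shift_index_def
    by (cases "x < k") (auto simp: not_less)
qed

section \<open>Consecutive \<open>T_i\<close> as Wronskians with one appended index, up to
  constants\<close>

theorem theorem5p2:
  fixes k :: nat and N :: "nat \<Rightarrow> nat" and i :: nat
  assumes "k \<ge> 3" and "i < k"
  shows "hirota_D2 (wh_T k N i) (wh_T k N (i + 1))
       - [:0, 1 / 2:] * hirota_D (wh_T k N i) (wh_T k N (i + 1))
       - smult (of_int (wh_K k N i) / 2) (wh_T k N i * wh_T k N (i + 1)) = 0"
proof -
  define xs where "xs = index_list k (shift_index i N)"
  define m where "m = (if i = k - 1 then 0 else i + 1 + k * N (i + 1))"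
  define \<tau> \<sigma> where "\<tau> = wronskian (map wh_p xs)" and "\<sigma> = wronskian (map wh_p (xs @ [m]))"
  have k: "k > 0" using assms by simp
  have xs: "distinct xs" "set xs = index_set k (shift_index i N)"
    by (simp_all add: xs_def index_list_def finite_index_set)
  obtain s where s: "wh_T k N i = smult s \<tau>"
    using wh_poly_wronskian[OF xs] assms(2) by (auto simp: wh_T_def \<tau>_def)
  obtain t where t: "wh_T k N (i + 1) = smult t \<sigma>"
  proof (cases "i = k - 1")
    case True
    define ys where "ys = index_list k N"
    have ys: "distinct ys" "set ys = index_set k N"
      by (simp_all add: ys_def index_list_def finite_index_set)
    have [simp]: "shift_index 0 N = N"
      by (rule ext) (simp add: shift_index_def)
    have T: "wh_T k N (i + 1) = wh_poly k N"
      using True k by (simp add: wh_T_def)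
    have m: "m = 0" and i: "i = k - 1"
      using True by (simp_all add: m_def)
    have "distinct ([0..<k] @ map ((+) k) ys)" "distinct (xs @ [m])"
      using xs ys by (auto simp: distinct_map m mem_index_set[OF k])
    moreover have "set ([0..<k] @ map ((+) k) ys) = set (xs @ [m])"
      using index_set_shift_index_full[OF k, of N] by (simp add: xs ys m i)
    ultimately have "mset ([0..<k] @ map ((+) k) ys) = mset (xs @ [m])"
      by (subst set_eq_iff_mset_eq_distinct[symmetric])
    then have "mset (map wh_p ([0..<k] @ map ((+) k) ys)) = mset (map wh_p (xs @ [m]))"
      by (metis mset_map)
    then obtain u where "wronskian (map wh_p ys) = smult u \<sigma>"
      unfolding \<sigma>_def using wronskian_wh_p_shift[of k ys] by (metis wronskian_permute)
    moreover obtain v where "wh_poly k N = smult v (wronskian (map wh_p ys))"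
      by (rule wh_poly_wronskian[OF ys])
    ultimately show thesis
      using that[of "v * u"] T by simp
  next
    case False
    then have i: "Suc i < k" using assms(2) by simp
    have m: "m = Suc i + k * N (Suc i)"
      using False by (simp add: m_def)
    have "distinct (xs @ [m])" "set (xs @ [m]) = index_set k (shift_index (Suc i) N)"
      using index_set_shift_index_Suc[OF i, of N] xs by (auto simp: m)
    then obtain u where "wh_poly k (shift_index (Suc i) N) = smult u \<sigma>"
      unfolding \<sigma>_def by (rule wh_poly_wronskian)
    then show thesis
      using that i by (simp add: wh_T_def)
  qed
  \<comment> \<open>As \<open>xs\<close> has length \<open>index_total k N + i\<close>, the summand
    \<open>i\<close> cancels for \<open>i < k - 1\<close>, and \<open>m = 0\<close> gives the
    exceptional last constant.\<close>
  have K: "wh_K k N i = int m - int (length xs)"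
    using assms unfolding xs_def length_index_list
    by (auto simp: wh_K_def m_def index_total_shift_index of_nat_diff)
  have "2 * hirota_D2 \<tau> \<sigma> - [:0, 1:] * hirota_D \<tau> \<sigma> - of_int (wh_K k N i) * (\<tau> * \<sigma>) = 0"
    unfolding K \<tau>_def \<sigma>_def by (rule wronskian_wh_p_bilinear)
  \<comment> \<open>The factor \<open>s * t\<close> restores the constants of the two polynomials;
    the half matches the stated normalisation.\<close>
  then have "smult (s * t / 2)
      (2 * hirota_D2 \<tau> \<sigma> - [:0, 1:] * hirota_D \<tau> \<sigma> - of_int (wh_K k N i) * (\<tau> * \<sigma>)) = 0"
    by simp
  moreover have "hirota_D2 (smult s \<tau>) (smult t \<sigma>) = smult (s * t) (hirota_D2 \<tau> \<sigma>)"
    by (simp add: hirota_D2_def pderiv_smult smult_add_right smult_diff_right mult.commute)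
  moreover have "hirota_D (smult s \<tau>) (smult t \<sigma>) = smult (s * t) (hirota_D \<tau> \<sigma>)"
    by (simp add: hirota_D_def pderiv_smult smult_diff_right mult.commute)
  ultimately show ?thesis
    unfolding s t
    by (simp add: of_int_poly smult_diff_right numeral_poly mult.commute)
qed

end
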